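(* Let $V$ be a countable set, let $r\ge1$ and let $K_r$ be a Markov transition operator on $V$. Let $\pi_r$ and $\pi_{r-1}$ be two positive finite measures on $V$. Assume that $\pi_r$ is an invariant measure for $K_r$ and that $\pi_r(x)\ge\pi_{r-1}(x)$ for all $x\in V$. Let $Q_r=K_r^*K_r$, where $K_r^*$ is the adjoint of $K_r$ on $\ell^2(\pi_r)$. Then $$\forall g\in\ell^2(\pi_r),\quad \mathcal E_{Q_r,\pi_r}(g,g)\le\left\|g-\tilde\pi_r(g)\right\|_{\ell^2(\pi_r)}^2-\left\|K_rg-\tilde\pi_{r-1}(K_rg)\right\|_{\ell^2(\pi_{r-1})}^2.$$
   Context: A Markov transition operator $K$ on $V$ is a map $K:V\times V\to[0,1]$ with $\sum_y K(x,y)=1$ for all $x$; $(Kf)(x)=\sum_yK(x,y)f(y)$; $\pi$ is invariant for $K$ if $\sum_x\pi(x)K(x,y)=\pi(y)$ for all $y$. Positive means $\pi(x)>0$ for all $x$. For a finite measure $\pi$, $\tilde\pi:=\pi/\pi(V)$, $\tilde\pi(f)=\sum_xf(x)\tilde\pi(x)$, $\|f\|_{\ell^2(\pi)}^2=\sum_xf(x)^2\pi(x)$. Dirichlet form: $\mathcal E_{Q,\pi}(f,f)=\langle(I-Q)f,f\rangle_\pi=\frac12\sum_{x,y}(f(x)-f(y))^2Q(x,y)\pi(x)$. *)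

theory Defs
  imports "HOL-Analysis.Infinite_Sum"
begin

(* The countable state space is a set V, and a measure on V is given by its point masses.
   Functions on V are total functions on the ambient type; only their values on V enter,
   since every sum ranges over V. *)

definition markov_operator :: "'a set \<Rightarrow> ('a \<Rightarrow> 'a \<Rightarrow> real) \<Rightarrow> bool" where
  "markov_operator V K \<longleftrightarrow>
     (\<forall>x\<in>V. \<forall>y\<in>V. 0 \<le> K x y \<and> K x y \<le> 1) \<and> (\<forall>x\<in>V. (K x has_sum 1) V)"

definition kernel_apply :: "'a set \<Rightarrow> ('a \<Rightarrow> 'a \<Rightarrow> real) \<Rightarrow> ('a \<Rightarrow> real) \<Rightarrow> 'a \<Rightarrow> real" where
  "kernel_apply V K f x = (\<Sum>\<^sub>\<infinity>y\<in>V. K x y * f y)"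

definition positive_finite_measure :: "'a set \<Rightarrow> ('a \<Rightarrow> real) \<Rightarrow> bool" where
  "positive_finite_measure V \<mu> \<longleftrightarrow> (\<forall>x\<in>V. \<mu> x > 0) \<and> \<mu> summable_on V"

definition invariant_measure :: "'a set \<Rightarrow> ('a \<Rightarrow> real) \<Rightarrow> ('a \<Rightarrow> 'a \<Rightarrow> real) \<Rightarrow> bool" where
  "invariant_measure V \<mu> K \<longleftrightarrow> (\<forall>y\<in>V. ((\<lambda>x. \<mu> x * K x y) has_sum \<mu> y) V)"

definition normalized :: "'a set \<Rightarrow> ('a \<Rightarrow> real) \<Rightarrow> 'a \<Rightarrow> real" where
  "normalized V \<mu> x = \<mu> x / (\<Sum>\<^sub>\<infinity>y\<in>V. \<mu> y)"

definition mean :: "'a set \<Rightarrow> ('a \<Rightarrow> real) \<Rightarrow> ('a \<Rightarrow> real) \<Rightarrow> real" where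
  "mean V \<mu> f = (\<Sum>\<^sub>\<infinity>x\<in>V. f x * \<mu> x)"

definition l2 :: "'a set \<Rightarrow> ('a \<Rightarrow> real) \<Rightarrow> ('a \<Rightarrow> real) set" where
  "l2 V \<mu> = {f. (\<lambda>x. (f x)\<^sup>2 * \<mu> x) summable_on V}"

definition l2_inner :: "'a set \<Rightarrow> ('a \<Rightarrow> real) \<Rightarrow> ('a \<Rightarrow> real) \<Rightarrow> ('a \<Rightarrow> real) \<Rightarrow> real" where
  "l2_inner V \<mu> f g = (\<Sum>\<^sub>\<infinity>x\<in>V. f x * g x * \<mu> x)"

definition l2_norm :: "'a set \<Rightarrow> ('a \<Rightarrow> real) \<Rightarrow> ('a \<Rightarrow> real) \<Rightarrow> real" where
  "l2_norm V \<mu> f = sqrt (\<Sum>\<^sub>\<infinity>x\<in>V. (f x)\<^sup>2 * \<mu> x)"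

(* For a positive measure, B f is determined on V for each f in l2 V \<mu>; the choice
   operator only affects values off V and arguments outside l2 V \<mu>. *)
definition l2_adjoint ::
  "'a set \<Rightarrow> ('a \<Rightarrow> real) \<Rightarrow> (('a \<Rightarrow> real) \<Rightarrow> 'a \<Rightarrow> real) \<Rightarrow> ('a \<Rightarrow> real) \<Rightarrow> 'a \<Rightarrow> real" where
  "l2_adjoint V \<mu> A = (SOME B. (\<forall>g\<in>l2 V \<mu>. B g \<in> l2 V \<mu>) \<and>
     (\<forall>f\<in>l2 V \<mu>. \<forall>g\<in>l2 V \<mu>. l2_inner V \<mu> (A f) g = l2_inner V \<mu> f (B g)))"

definition dirichlet_form ::
  "'a set \<Rightarrow> (('a \<Rightarrow> real) \<Rightarrow> 'a \<Rightarrow> real) \<Rightarrow> ('a \<Rightarrow> real) \<Rightarrow> ('a \<Rightarrow> real) \<Rightarrow> ('a \<Rightarrow> real) \<Rightarrow> real" where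
  "dirichlet_form V Q \<mu> f g = l2_inner V \<mu> (\<lambda>x. f x - Q f x) g"

end

theory Submission
  imports Defs
begin

text \<open>
  Write \<open>\<mu>\<close>, \<open>\<nu>\<close> for the two measures and \<open>h = K g\<close>. Invariance makes \<open>K\<close> a contraction
  of \<open>\<ell>\<^sup>2(\<mu>)\<close> by Jensen's inequality, and its adjoint is given by the time-reversed kernel
  \<open>\<mu> x * K x y / \<mu> y\<close>. Hence the Dirichlet form equals \<open>\<parallel>g\<parallel>\<^sup>2 - \<parallel>h\<parallel>\<^sup>2\<close> in \<open>\<ell>\<^sup>2(\<mu>)\<close>. As \<open>g\<close> and
  \<open>h\<close> have the same \<open>\<mu>\<close>-mean, this is the difference of their \<open>\<mu>\<close>-variances. The centered
  norm of \<open>h\<close> only decreases in passing to \<open>\<nu> \<le> \<mu>\<close>, because the \<open>\<nu>\<close>-mean minimizes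
  \<open>\<Sum>\<^sub>x (h x - c)\<^sup>2 \<nu> x\<close> over \<open>c\<close>.
\<close>

lemma summable_on_real_bound:
  fixes f g :: "'a \<Rightarrow> real"
  assumes "g summable_on A" and "\<And>x. x \<in> A \<Longrightarrow> norm (f x) \<le> g x"
  shows "f summable_on A"
  using abs_summable_on_comparison_test'[OF assms] summable_on_iff_abs_summable_on_real by blast

lemma has_sum_diff:
  fixes f g :: "'a \<Rightarrow> real"
  assumes "(f has_sum a) A" "(g has_sum b) A"
  shows "((\<lambda>x. f x - g x) has_sum (a - b)) A"
  using has_sum_add[OF assms(1) has_sum_uminusI[OF assms(2)]] by simp

lemma abs_mult_le_sum_power2:
  fixes a b :: real
  shows "\<bar>a * b\<bar> \<le> a\<^sup>2 + b\<^sup>2"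
proof -
  have "2 * \<bar>a * b\<bar> \<le> a\<^sup>2 + b\<^sup>2"
    using sum_squares_bound[of "\<bar>a\<bar>" "\<bar>b\<bar>"] by (simp add: abs_mult)
  then show ?thesis using abs_ge_zero[of "a * b"] by linarith
qed

lemma l2_mult_summable:
  assumes \<mu>: "\<forall>x\<in>V. \<mu> x \<ge> 0" and f: "f \<in> l2 V \<mu>" and g: "g \<in> l2 V \<mu>"
  shows "(\<lambda>x. f x * g x * \<mu> x) summable_on V"
proof (rule summable_on_real_bound)
  show "(\<lambda>x. (f x)\<^sup>2 * \<mu> x + (g x)\<^sup>2 * \<mu> x) summable_on V"
    using f g by (auto simp: l2_def intro: summable_on_add)
  fix x assume "x \<in> V"
  have "\<bar>f x * g x\<bar> \<le> (f x)\<^sup>2 + (g x)\<^sup>2"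
    by (rule abs_mult_le_sum_power2)
  then show "norm (f x * g x * \<mu> x) \<le> (f x)\<^sup>2 * \<mu> x + (g x)\<^sup>2 * \<mu> x"
    using \<mu> \<open>x \<in> V\<close> mult_right_mono[of "\<bar>f x * g x\<bar>" "(f x)\<^sup>2 + (g x)\<^sup>2" "\<mu> x"]
    by (simp add: abs_mult distrib_right)
qed

lemma l2_diff:
  assumes \<mu>: "\<forall>x\<in>V. \<mu> x \<ge> 0" and f: "f \<in> l2 V \<mu>" and g: "g \<in> l2 V \<mu>"
  shows "(\<lambda>x. f x - g x) \<in> l2 V \<mu>"
proof -
  have "(\<lambda>x. (f x)\<^sup>2 * \<mu> x + (g x)\<^sup>2 * \<mu> x + (- 2) * (f x * g x * \<mu> x)) summable_on V"
    using f g l2_mult_summable[OF assms]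
    by (intro summable_on_add summable_on_cmult_right) (auto simp: l2_def)
  then show ?thesis
    by (simp add: l2_def power2_diff algebra_simps)
qed

lemma const_in_l2: "\<mu> summable_on V \<Longrightarrow> (\<lambda>_. c) \<in> l2 V \<mu>"
  by (simp add: l2_def summable_on_cmult_right)

lemma l2_mono:
  assumes "f \<in> l2 V \<mu>" and "\<forall>x\<in>V. 0 \<le> \<nu> x \<and> \<nu> x \<le> \<mu> x"
  shows "f \<in> l2 V \<nu>"
  unfolding l2_def mem_Collect_eq
proof (rule summable_on_real_bound)
  show "(\<lambda>x. (f x)\<^sup>2 * \<mu> x) summable_on V"
    using assms(1) by (simp add: l2_def)
qed (use assms(2) in \<open>auto intro: mult_left_mono\<close>)

lemma l2_norm_power2:
  assumes "\<forall>x\<in>V. \<mu> x \<ge> 0"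
  shows "(l2_norm V \<mu> f)\<^sup>2 = l2_inner V \<mu> f f"
  using assms by (simp add: l2_norm_def l2_inner_def infsum_nonneg power2_eq_square)

lemma l2_inner_diff_left:
  assumes "\<forall>x\<in>V. \<mu> x \<ge> 0" and "f \<in> l2 V \<mu>" "g \<in> l2 V \<mu>" "h \<in> l2 V \<mu>"
  shows "l2_inner V \<mu> (\<lambda>x. f x - g x) h = l2_inner V \<mu> f h - l2_inner V \<mu> g h"
  unfolding l2_inner_def
  using has_sum_diff[OF has_sum_infsum[OF l2_mult_summable[OF assms(1,2,4)]]
      has_sum_infsum[OF l2_mult_summable[OF assms(1,3,4)]]]
  by (simp add: left_diff_distrib infsumI)

lemma l2_norm_diff_const:
  assumes \<mu>: "\<forall>x\<in>V. \<mu> x \<ge> 0" and fin: "\<mu> summable_on V" and f: "f \<in> l2 V \<mu>"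
  shows "(l2_norm V \<mu> (\<lambda>x. f x - c))\<^sup>2 =
    l2_inner V \<mu> f f - 2 * c * (\<Sum>\<^sub>\<infinity>x\<in>V. f x * \<mu> x) + c\<^sup>2 * (\<Sum>\<^sub>\<infinity>x\<in>V. \<mu> x)"
proof -
  have f1: "(\<lambda>x. f x * \<mu> x) summable_on V"
    using l2_mult_summable[OF \<mu> f const_in_l2[OF fin, of 1]] by simp
  have "((\<lambda>x. f x * f x * \<mu> x - 2 * c * (f x * \<mu> x) + c\<^sup>2 * \<mu> x) has_sum
      (l2_inner V \<mu> f f - 2 * c * (\<Sum>\<^sub>\<infinity>x\<in>V. f x * \<mu> x) + c\<^sup>2 * (\<Sum>\<^sub>\<infinity>x\<in>V. \<mu> x))) V"
    unfolding l2_inner_def using l2_mult_summable[OF \<mu> f f] f1 fin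
    by (intro has_sum_add has_sum_diff has_sum_cmult_right has_sum_infsum)
  moreover have "f x * f x * \<mu> x - 2 * c * (f x * \<mu> x) + c\<^sup>2 * \<mu> x = (f x - c) * (f x - c) * \<mu> x" for x
    by (simp add: algebra_simps power2_eq_square)
  ultimately show ?thesis
    unfolding l2_norm_power2[OF \<mu>] by (subst (1) l2_inner_def) (simp add: infsumI)
qed

lemma mean_normalized:
  "mean V (normalized V \<mu>) f = (\<Sum>\<^sub>\<infinity>x\<in>V. f x * \<mu> x) / (\<Sum>\<^sub>\<infinity>x\<in>V. \<mu> x)"
  by (simp add: mean_def normalized_def divide_inverse infsum_cmult_left' flip: mult.assoc)

lemma mean_normalized_times_mass:
  assumes "positive_finite_measure V \<mu>"
  shows "mean V (normalized V \<mu>) f * (\<Sum>\<^sub>\<infinity>x\<in>V. \<mu> x) = (\<Sum>\<^sub>\<infinity>x\<in>V. f x * \<mu> x)"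
proof (cases "V = {}")
  case False
  then obtain x where x: "x \<in> V" by auto
  have "(\<Sum>\<^sub>\<infinity>x\<in>V. \<mu> x) \<noteq> 0"
    using nonneg_infsum_le_0D[of \<mu> V x] assms x
    by (force simp: positive_finite_measure_def intro: less_imp_le)
  then show ?thesis by (simp add: mean_normalized)
qed simp

lemma l2_norm_diff_mean:
  assumes \<mu>: "positive_finite_measure V \<mu>" and f: "f \<in> l2 V \<mu>"
  defines "m \<equiv> mean V (normalized V \<mu>) f"
  shows "(l2_norm V \<mu> (\<lambda>x. f x - m))\<^sup>2 = l2_inner V \<mu> f f - m\<^sup>2 * (\<Sum>\<^sub>\<infinity>x\<in>V. \<mu> x)"
    and "(l2_norm V \<mu> (\<lambda>x. f x - m))\<^sup>2 \<le> (l2_norm V \<mu> (\<lambda>x. f x - c))\<^sup>2"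
proof -
  have nn: "\<forall>x\<in>V. \<mu> x \<ge> 0" and fin: "\<mu> summable_on V"
    using \<mu> by (auto simp: positive_finite_measure_def intro: less_imp_le)
  let ?M = "\<Sum>\<^sub>\<infinity>x\<in>V. \<mu> x"
  have M: "?M \<ge> 0" using nn by (auto intro: infsum_nonneg)
  have S: "(\<Sum>\<^sub>\<infinity>x\<in>V. f x * \<mu> x) = m * ?M"
    using mean_normalized_times_mass[OF \<mu>, of f] by (simp add: m_def)
  note expand = l2_norm_diff_const[OF nn fin f, unfolded S]
  show "(l2_norm V \<mu> (\<lambda>x. f x - m))\<^sup>2 = l2_inner V \<mu> f f - m\<^sup>2 * ?M"
    unfolding expand by (simp add: power2_eq_square)
  have "(l2_norm V \<mu> (\<lambda>x. f x - c))\<^sup>2 - (l2_norm V \<mu> (\<lambda>x. f x - m))\<^sup>2 = (m - c)\<^sup>2 * ?M"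
    unfolding expand by (simp add: power2_eq_square algebra_simps)
  also have "\<dots> \<ge> 0" using M by simp
  finally show "(l2_norm V \<mu> (\<lambda>x. f x - m))\<^sup>2 \<le> (l2_norm V \<mu> (\<lambda>x. f x - c))\<^sup>2" by simp
qed

lemma l2_norm_mono:
  assumes "f \<in> l2 V \<mu>" and "\<forall>x\<in>V. 0 \<le> \<nu> x \<and> \<nu> x \<le> \<mu> x"
  shows "l2_norm V \<nu> f \<le> l2_norm V \<mu> f"
  unfolding l2_norm_def
proof (intro real_sqrt_le_mono infsum_mono)
  show "(\<lambda>x. (f x)\<^sup>2 * \<nu> x) summable_on V" "(\<lambda>x. (f x)\<^sup>2 * \<mu> x) summable_on V"
    using l2_mono[OF assms] assms(1) by (simp_all add: l2_def)
qed (use assms(2) in \<open>auto intro: mult_left_mono\<close>)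

locale invariant_kernel =
  fixes V :: "'a set" and A :: "'a \<Rightarrow> 'a \<Rightarrow> real" and \<mu> :: "'a \<Rightarrow> real"
  assumes markov: "markov_operator V A"
    and pos_fin: "positive_finite_measure V \<mu>"
    and inv: "invariant_measure V \<mu> A"
begin

lemma kernel_nonneg: "x \<in> V \<Longrightarrow> y \<in> V \<Longrightarrow> A x y \<ge> 0"
  using markov by (auto simp: markov_operator_def)

lemma kernel_has_sum: "x \<in> V \<Longrightarrow> (A x has_sum 1) V"
  using markov by (auto simp: markov_operator_def)

lemma weight_pos: "x \<in> V \<Longrightarrow> \<mu> x > 0"
  using pos_fin by (auto simp: positive_finite_measure_def)

lemma weight_nonneg: "\<forall>x\<in>V. \<mu> x \<ge> 0"
  using weight_pos by (auto intro: less_imp_le)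

lemma weight_summable: "\<mu> summable_on V"
  using pos_fin by (auto simp: positive_finite_measure_def)

lemma weight_invariant: "y \<in> V \<Longrightarrow> ((\<lambda>x. \<mu> x * A x y) has_sum \<mu> y) V"
  using inv by (auto simp: invariant_measure_def)

lemma l2_source_summable:
  assumes "g \<in> l2 V \<mu>"
  shows "(\<lambda>(x, y). (g x)\<^sup>2 * \<mu> x * A x y) summable_on V \<times> V"
proof (rule summable_on_SigmaI[where g = "\<lambda>x. (g x)\<^sup>2 * \<mu> x"])
  show "((\<lambda>y. case (x, y) of (x, y) \<Rightarrow> (g x)\<^sup>2 * \<mu> x * A x y) has_sum (g x)\<^sup>2 * \<mu> x) V"
    if "x \<in> V" for x
    using has_sum_cmult_right[OF kernel_has_sum[OF that], of "(g x)\<^sup>2 * \<mu> x"] by simp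
qed (use assms weight_nonneg kernel_nonneg in \<open>auto simp: l2_def\<close>)

lemma l2_target_summable:
  assumes "f \<in> l2 V \<mu>"
  shows "(\<lambda>(x, y). (f y)\<^sup>2 * (\<mu> x * A x y)) summable_on V \<times> V"
proof -
  have "(\<lambda>(y, x). (f y)\<^sup>2 * (\<mu> x * A x y)) summable_on V \<times> V"
  proof (rule summable_on_SigmaI[where g = "\<lambda>y. (f y)\<^sup>2 * \<mu> y"])
    show "((\<lambda>x. case (y, x) of (y, x) \<Rightarrow> (f y)\<^sup>2 * (\<mu> x * A x y)) has_sum (f y)\<^sup>2 * \<mu> y) V"
      if "y \<in> V" for y
      using has_sum_cmult_right[OF weight_invariant[OF that], of "(f y)\<^sup>2"] by simp
  qed (use assms weight_nonneg kernel_nonneg in \<open>auto simp: l2_def\<close>)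
  then show ?thesis
    by (subst summable_on_swap) (simp add: case_prod_unfold)
qed

lemma pairing_summable:
  assumes "f \<in> l2 V \<mu>" "g \<in> l2 V \<mu>"
  shows "(\<lambda>(x, y). \<mu> x * A x y * f y * g x) summable_on V \<times> V"
proof (rule summable_on_real_bound)
  show "(\<lambda>z. (\<lambda>(x, y). (g x)\<^sup>2 * \<mu> x * A x y) z + (\<lambda>(x, y). (f y)\<^sup>2 * (\<mu> x * A x y)) z)
    summable_on V \<times> V"
    by (intro summable_on_add l2_source_summable l2_target_summable assms)
  fix z assume "z \<in> V \<times> V"
  then obtain x y where z: "z = (x, y)" "x \<in> V" "y \<in> V" by auto
  have w: "\<mu> x * A x y \<ge> 0"
    using z weight_nonneg kernel_nonneg by auto
  have "\<bar>f y * g x\<bar> \<le> (g x)\<^sup>2 + (f y)\<^sup>2"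
    using abs_mult_le_sum_power2[of "g x" "f y"] by (simp add: mult.commute)
  from mult_left_mono[OF this w]
  have "\<bar>\<mu> x * A x y\<bar> * \<bar>f y * g x\<bar> \<le> (\<mu> x * A x y) * ((g x)\<^sup>2 + (f y)\<^sup>2)"
    using w by simp
  then show "norm ((\<lambda>(x, y). \<mu> x * A x y * f y * g x) z) \<le>
      (\<lambda>(x, y). (g x)\<^sup>2 * \<mu> x * A x y) z + (\<lambda>(x, y). (f y)\<^sup>2 * (\<mu> x * A x y)) z"
    by (simp add: z abs_mult algebra_simps)
qed

lemma kernel_square_summable:
  assumes "f \<in> l2 V \<mu>" "x \<in> V"
  shows "(\<lambda>y. A x y * (f y)\<^sup>2) summable_on V"
proof -
  have "(\<lambda>y. (f y)\<^sup>2 * (\<mu> x * A x y)) summable_on V"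
    using summable_on_SigmaD1[OF l2_target_summable[OF assms(1)] assms(2)] by simp
  then have "(\<lambda>y. inverse (\<mu> x) * ((f y)\<^sup>2 * (\<mu> x * A x y))) summable_on V"
    by (rule summable_on_cmult_right)
  then show ?thesis
    using weight_pos[OF assms(2)] by (simp add: field_simps)
qed

lemma kernel_apply_power2_le:
  assumes "f \<in> l2 V \<mu>" "x \<in> V"
  shows "(kernel_apply V A f x)\<^sup>2 \<le> (\<Sum>\<^sub>\<infinity>y\<in>V. A x y * (f y)\<^sup>2)"
proof -
  define c where "c = kernel_apply V A f x"
  have f: "f \<in> l2 V (A x)"
    using kernel_square_summable[OF assms] by (simp add: l2_def mult.commute)
  have A: "\<forall>y\<in>V. A x y \<ge> 0" "A x summable_on V" "infsum (A x) V = 1"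
    using kernel_nonneg kernel_has_sum[OF assms(2)] assms(2)
    by (auto simp: summable_on_def infsumI)
  have "0 \<le> (l2_norm V (A x) (\<lambda>y. f y - c))\<^sup>2" by simp
  also have "\<dots> = (\<Sum>\<^sub>\<infinity>y\<in>V. A x y * (f y)\<^sup>2) - c\<^sup>2"
    using l2_norm_diff_const[OF A(1,2) f, of c] A(3)
    by (simp add: l2_inner_def c_def kernel_apply_def power2_eq_square mult.commute)
  finally show ?thesis by (simp add: c_def)
qed

lemma kernel_apply_in_l2:
  assumes "f \<in> l2 V \<mu>"
  shows "kernel_apply V A f \<in> l2 V \<mu>"
  unfolding l2_def mem_Collect_eq
proof (rule summable_on_real_bound)
  show "(\<lambda>x. \<Sum>\<^sub>\<infinity>y\<in>V. (f y)\<^sup>2 * (\<mu> x * A x y)) summable_on V"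
    using summable_on_Sigma_banach[of "\<lambda>x y. (f y)\<^sup>2 * (\<mu> x * A x y)"] l2_target_summable[OF assms]
    by simp
  fix x assume x: "x \<in> V"
  have "(kernel_apply V A f x)\<^sup>2 * \<mu> x \<le> (\<Sum>\<^sub>\<infinity>y\<in>V. A x y * (f y)\<^sup>2) * \<mu> x"
    using kernel_apply_power2_le[OF assms x] weight_nonneg x by (intro mult_right_mono) auto
  also have "\<dots> = (\<Sum>\<^sub>\<infinity>y\<in>V. (f y)\<^sup>2 * (\<mu> x * A x y))"
    using infsum_cmult_left'[of "\<lambda>y. A x y * (f y)\<^sup>2" "\<mu> x" V] by (simp add: mult_ac)
  finally show "norm ((kernel_apply V A f x)\<^sup>2 * \<mu> x) \<le> (\<Sum>\<^sub>\<infinity>y\<in>V. (f y)\<^sup>2 * (\<mu> x * A x y))"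
    using weight_nonneg x by simp
qed

definition reversed :: "'a \<Rightarrow> 'a \<Rightarrow> real" where
  "reversed y x = \<mu> x * A x y / \<mu> y"

lemma weight_reversed: "y \<in> V \<Longrightarrow> \<mu> y * reversed y x = \<mu> x * A x y"
  using weight_pos[of y] by (simp add: reversed_def)

lemma reversed_invariant_kernel: "invariant_kernel V reversed \<mu>"
proof
  have sum1: "(reversed y has_sum 1) V" if "y \<in> V" for y
    using has_sum_divide_const[OF weight_invariant[OF that], of "\<mu> y"] weight_pos[OF that]
    by (simp add: reversed_def[abs_def])
  have nn: "reversed y x \<ge> 0" if "x \<in> V" "y \<in> V" for x y
    using that kernel_nonneg weight_nonneg by (auto simp: reversed_def)
  have "reversed y x \<le> 1" if "x \<in> V" "y \<in> V" for x y
  proof -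
    have "sum (reversed y) {x} \<le> 1"
      using that nn by (intro has_sum_mono_neutral[OF has_sum_finite sum1[OF that(2)]]) auto
    then show ?thesis by simp
  qed
  with sum1 nn show "markov_operator V reversed"
    by (auto simp: markov_operator_def)
  show "invariant_measure V \<mu> reversed"
    unfolding invariant_measure_def
  proof
    fix x assume x: "x \<in> V"
    have "((\<lambda>y. \<mu> y * reversed y x) has_sum \<mu> x) V \<longleftrightarrow> ((\<lambda>y. \<mu> x * A x y) has_sum \<mu> x) V"
      by (intro has_sum_cong weight_reversed)
    with has_sum_cmult_right[OF kernel_has_sum[OF x], of "\<mu> x"]
    show "((\<lambda>y. \<mu> y * reversed y x) has_sum \<mu> x) V" by simp
  qed
qed (rule pos_fin)

lemma l2_inner_reversed:
  assumes "f \<in> l2 V \<mu>" "g \<in> l2 V \<mu>"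
  shows "l2_inner V \<mu> (kernel_apply V A f) g = l2_inner V \<mu> f (kernel_apply V reversed g)"
proof -
  have "l2_inner V \<mu> (kernel_apply V A f) g = (\<Sum>\<^sub>\<infinity>x\<in>V. \<Sum>\<^sub>\<infinity>y\<in>V. \<mu> x * A x y * f y * g x)"
    unfolding l2_inner_def kernel_apply_def
  proof (intro infsum_cong)
    fix x
    show "(\<Sum>\<^sub>\<infinity>y\<in>V. A x y * f y) * g x * \<mu> x = (\<Sum>\<^sub>\<infinity>y\<in>V. \<mu> x * A x y * f y * g x)"
      using infsum_cmult_left'[of "\<lambda>y. A x y * f y" "g x * \<mu> x" V] by (simp add: mult_ac)
  qed
  also have "\<dots> = (\<Sum>\<^sub>\<infinity>y\<in>V. \<Sum>\<^sub>\<infinity>x\<in>V. \<mu> x * A x y * f y * g x)"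
    by (rule infsum_swap_banach[OF pairing_summable[OF assms]])
  also have "\<dots> = (\<Sum>\<^sub>\<infinity>y\<in>V. \<Sum>\<^sub>\<infinity>x\<in>V. \<mu> y * reversed y x * f y * g x)"
    by (intro infsum_cong) (simp add: weight_reversed)
  also have "\<dots> = l2_inner V \<mu> f (kernel_apply V reversed g)"
    unfolding l2_inner_def kernel_apply_def
  proof (intro infsum_cong)
    fix y
    show "(\<Sum>\<^sub>\<infinity>x\<in>V. \<mu> y * reversed y x * f y * g x) = f y * (\<Sum>\<^sub>\<infinity>x\<in>V. reversed y x * g x) * \<mu> y"
      using infsum_cmult_left'[of "\<lambda>x. reversed y x * g x" "f y * \<mu> y" V] by (simp add: mult_ac)
  qed
  finally show ?thesis .
qed

lemma l2_adjoint_kernel_apply: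
  defines "B \<equiv> l2_adjoint V \<mu> (kernel_apply V A)"
  shows "\<forall>g\<in>l2 V \<mu>. B g \<in> l2 V \<mu>"
    and "\<forall>f\<in>l2 V \<mu>. \<forall>g\<in>l2 V \<mu>.
      l2_inner V \<mu> (kernel_apply V A f) g = l2_inner V \<mu> f (B g)"
proof -
  interpret R: invariant_kernel V reversed \<mu> by (rule reversed_invariant_kernel)
  have "(\<forall>g\<in>l2 V \<mu>. B g \<in> l2 V \<mu>) \<and> (\<forall>f\<in>l2 V \<mu>. \<forall>g\<in>l2 V \<mu>.
      l2_inner V \<mu> (kernel_apply V A f) g = l2_inner V \<mu> f (B g))"
    unfolding B_def l2_adjoint_def
    by (rule someI[where x = "kernel_apply V reversed"])
       (simp add: R.kernel_apply_in_l2 l2_inner_reversed)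
  then show "\<forall>g\<in>l2 V \<mu>. B g \<in> l2 V \<mu>"
    and "\<forall>f\<in>l2 V \<mu>. \<forall>g\<in>l2 V \<mu>.
      l2_inner V \<mu> (kernel_apply V A f) g = l2_inner V \<mu> f (B g)"
    by auto
qed

lemma mean_kernel_apply:
  assumes "f \<in> l2 V \<mu>"
  shows "mean V (normalized V \<mu>) (kernel_apply V A f) = mean V (normalized V \<mu>) f"
proof -
  interpret R: invariant_kernel V reversed \<mu> by (rule reversed_invariant_kernel)
  have "l2_inner V \<mu> f (kernel_apply V reversed (\<lambda>_. 1)) = l2_inner V \<mu> f (\<lambda>_. 1)"
    unfolding l2_inner_def kernel_apply_def
    by (intro infsum_cong) (simp add: infsumI[OF R.kernel_has_sum])
  with l2_inner_reversed[OF assms const_in_l2[OF weight_summable, of 1]]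
  show ?thesis
    by (simp add: mean_normalized l2_inner_def)
qed

lemma dirichlet_form_adjoint_comp:
  assumes g: "g \<in> l2 V \<mu>"
  shows "dirichlet_form V (l2_adjoint V \<mu> (kernel_apply V A) \<circ> kernel_apply V A) \<mu> g g =
    l2_inner V \<mu> g g - l2_inner V \<mu> (kernel_apply V A g) (kernel_apply V A g)"
proof -
  let ?h = "kernel_apply V A g" and ?B = "l2_adjoint V \<mu> (kernel_apply V A)"
  have h: "?h \<in> l2 V \<mu>" and Bh: "?B ?h \<in> l2 V \<mu>"
    using kernel_apply_in_l2[OF g] l2_adjoint_kernel_apply(1) by auto
  have "l2_inner V \<mu> ?h ?h = l2_inner V \<mu> g (?B ?h)"
    using l2_adjoint_kernel_apply(2) g h by blast
  also have "\<dots> = l2_inner V \<mu> (?B ?h) g"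
    by (simp add: l2_inner_def mult.commute)
  finally show ?thesis
    by (simp add: dirichlet_form_def l2_inner_diff_left[OF weight_nonneg g Bh g])
qed

end

theorem proposition3p10:
  fixes V :: "'a set"
    and r :: nat
    and K :: "nat \<Rightarrow> 'a \<Rightarrow> 'a \<Rightarrow> real"
    and \<mu> :: "nat \<Rightarrow> 'a \<Rightarrow> real"
    and Q :: "('a \<Rightarrow> real) \<Rightarrow> 'a \<Rightarrow> real"
  assumes "countable V"
    and "r \<ge> 1"
    and "markov_operator V (K r)"
    and "positive_finite_measure V (\<mu> r)"
    and "positive_finite_measure V (\<mu> (r - 1))"
    and "invariant_measure V (\<mu> r) (K r)"
    and "\<forall>x\<in>V. \<mu> r x \<ge> \<mu> (r - 1) x"
    and "Q = l2_adjoint V (\<mu> r) (kernel_apply V (K r)) \<circ> kernel_apply V (K r)"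
  shows "\<forall>g\<in>l2 V (\<mu> r).
    dirichlet_form V Q (\<mu> r) g g \<le>
      (l2_norm V (\<mu> r) (\<lambda>x. g x - mean V (normalized V (\<mu> r)) g))\<^sup>2
      - (l2_norm V (\<mu> (r - 1))
           (\<lambda>x. kernel_apply V (K r) g x
                  - mean V (normalized V (\<mu> (r - 1))) (kernel_apply V (K r) g)))\<^sup>2"
proof
  interpret invariant_kernel V "K r" "\<mu> r"
    using assms by unfold_locales
  fix g assume g: "g \<in> l2 V (\<mu> r)"
  let ?h = "kernel_apply V (K r) g" and ?\<nu> = "\<mu> (r - 1)"
  define m where "m = mean V (normalized V (\<mu> r)) g"
  have h: "?h \<in> l2 V (\<mu> r)" by (rule kernel_apply_in_l2[OF g])
  have le: "\<forall>x\<in>V. 0 \<le> ?\<nu> x \<and> ?\<nu> x \<le> \<mu> r x"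
    using assms(5,7) by (auto simp: positive_finite_measure_def intro: less_imp_le)
  have "(l2_norm V ?\<nu> (\<lambda>x. ?h x - mean V (normalized V ?\<nu>) ?h))\<^sup>2
      \<le> (l2_norm V ?\<nu> (\<lambda>x. ?h x - m))\<^sup>2"
    by (rule l2_norm_diff_mean(2)[OF assms(5) l2_mono[OF h le]])
  also have "\<dots> \<le> (l2_norm V (\<mu> r) (\<lambda>x. ?h x - m))\<^sup>2"
    using le by (intro power_mono l2_norm_mono l2_diff h const_in_l2 weight_nonneg weight_summable)
      (auto simp: l2_norm_def intro!: infsum_nonneg)
  also have "\<dots> = l2_inner V (\<mu> r) ?h ?h - m\<^sup>2 * (\<Sum>\<^sub>\<infinity>x\<in>V. \<mu> r x)"
    using l2_norm_diff_mean(1)[OF pos_fin h] mean_kernel_apply[OF g] by (simp add: m_def)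
  finally show "dirichlet_form V Q (\<mu> r) g g \<le>
      (l2_norm V (\<mu> r) (\<lambda>x. g x - mean V (normalized V (\<mu> r)) g))\<^sup>2
      - (l2_norm V ?\<nu> (\<lambda>x. ?h x - mean V (normalized V ?\<nu>) ?h))\<^sup>2"
    using l2_norm_diff_mean(1)[OF pos_fin g] dirichlet_form_adjoint_comp[OF g]
    by (simp add: assms(8) m_def)
qed

end
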